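(* The Cauchy problem $(\mathcal M_1)$ $$\partial_t f(t,x)=\frac{\rho}{2\pi}\,\mathrm{P.V.}\!\int_{\mathbb R^2}\nabla_x\Delta_y f(t,x)\cdot\frac{y}{|y|^2}\,\frac{1}{(1+(\Delta_y f(t,x))^2)^{3/2}}\,dy,\qquad f(0,x)=f_0(x),$$ is equivalent to the Cauchy problem $(\mathcal M_2)$ $$\partial_t f(t,x)=\frac{\rho}{2\pi}\,\mathrm{P.V.}\!\int_{\mathbb R^2}\nabla_x\Delta_y f(t,x)\cdot\frac{y}{|y|^2}\,\cos\big(\arctan(\Delta_y f(t,x))\big)\int_0^\infty e^{-k}\cos\big(k\,\Delta_y f(t,x)\big)\,dk\,dy,\qquad f(0,x)=f_0(x);$$ that is, $f$ solves $(\mathcal M_1)$ if and only if $f$ solves $(\mathcal M_2)$.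
   Context: Here $f=f(t,x)$ with $x\in\mathbb R^2$, $t\in[0,T]$, $\rho>0$ is a constant, and $\Delta_y f(t,x)=\frac{f(t,x)-f(t,x-y)}{|y|}$ for $y\in\mathbb R^2\setminus\{0\}$. *)

theory Defs
  imports "HOL-Analysis.Analysis"
begin

text \<open>\<open>\<Delta>\<^sub>y g(x) = (g(x) - g(x - y)) / |y|\<close>, of interest for \<open>y \<noteq> 0\<close> only.\<close>

definition Delta :: "real^2 \<Rightarrow> (real^2 \<Rightarrow> real) \<Rightarrow> real^2 \<Rightarrow> real" where
  "Delta y g x = (g x - g (x - y)) / norm y"

definition grad :: "(real^2 \<Rightarrow> real) \<Rightarrow> real^2 \<Rightarrow> real^2" where
  "grad g x = (THE D. GDERIV g x :> D)"

lemma grad_eqI: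
  assumes "GDERIV g x :> D"
  shows "grad g x = D"
  unfolding grad_def
proof (rule the_equality)
  fix D' assume "GDERIV g x :> D'"
  then have "(\<lambda>h. h \<bullet> D') = (\<lambda>h. h \<bullet> D)"
    using assms has_derivative_unique unfolding gderiv_def by blast
  then show "D' = D"
    by (simp add: fun_eq_iff inner_commute vector_eq_ldot)
qed (rule assms)

text \<open>
  Principal value at the origin and at infinity: the integrand is in general only of size
  \<open>|y|\<^sup>-\<^sup>2\<close> at infinity, so the integral over the plane need not converge absolutely there either.
  The inner and the outer truncation radius tend to their limits independently.
\<close>

definition has_pv_integral :: "(real^2 \<Rightarrow> real) \<Rightarrow> real \<Rightarrow> bool" where
  "has_pv_integral h I \<longleftrightarrow>
     (\<forall>\<epsilon> R. 0 < \<epsilon> \<longrightarrow> set_integrable lebesgue {y. \<epsilon> < norm y \<and> norm y < R} h) \<and>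
     ((\<lambda>(\<epsilon>, R). LINT y:{y. \<epsilon> < norm y \<and> norm y < R}|lebesgue. h y) \<longlongrightarrow> I)
       (at_right 0 \<times>\<^sub>F at_top)"

definition integrand_M1 :: "(real^2 \<Rightarrow> real) \<Rightarrow> real^2 \<Rightarrow> real^2 \<Rightarrow> real" where
  "integrand_M1 g x y =
     (grad (Delta y g) x \<bullet> (y /\<^sub>R (norm y)\<^sup>2)) *
     (1 / (1 + (Delta y g x)\<^sup>2) powr (3/2))"

definition integrand_M2 :: "(real^2 \<Rightarrow> real) \<Rightarrow> real^2 \<Rightarrow> real^2 \<Rightarrow> real" where
  "integrand_M2 g x y =
     (grad (Delta y g) x \<bullet> (y /\<^sub>R (norm y)\<^sup>2)) *
     cos (arctan (Delta y g x)) *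
     (LBINT k:{0..}. exp (- k) * cos (k * Delta y g x))"

text \<open>
  Classical (pointwise) solutions on \<open>[0, T]\<close>; the time derivative is one-sided at the end points.
  The only spatial regularity imposed is what gives the equation a meaning: the gradient of
  \<open>\<Delta>\<^sub>y f(t, \<cdot>)\<close> exists for every \<open>y \<noteq> 0\<close> (as it does if \<open>f(t, \<cdot>)\<close> is differentiable), and the
  principal value exists.
\<close>

definition solves_cauchy ::
  "((real^2 \<Rightarrow> real) \<Rightarrow> real^2 \<Rightarrow> real^2 \<Rightarrow> real) \<Rightarrow>
   real \<Rightarrow> real \<Rightarrow> (real^2 \<Rightarrow> real) \<Rightarrow> (real \<Rightarrow> real^2 \<Rightarrow> real) \<Rightarrow> bool" where
  "solves_cauchy F \<rho> T f0 f \<longleftrightarrow>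
     (\<forall>t\<in>{0..T}. \<forall>x.
        (\<forall>y. y \<noteq> 0 \<longrightarrow> Delta y (f t) differentiable (at x)) \<and>
        (\<exists>I. has_pv_integral (F (f t) x) I \<and>
             ((\<lambda>s. f s x) has_real_derivative \<rho> / (2 * pi) * I) (at t within {0..T}))) \<and>
     (\<forall>x. f 0 x = f0 x)"

definition solves_M1 ::
  "real \<Rightarrow> real \<Rightarrow> (real^2 \<Rightarrow> real) \<Rightarrow> (real \<Rightarrow> real^2 \<Rightarrow> real) \<Rightarrow> bool" where
  "solves_M1 = solves_cauchy integrand_M1"

definition solves_M2 ::
  "real \<Rightarrow> real \<Rightarrow> (real^2 \<Rightarrow> real) \<Rightarrow> (real \<Rightarrow> real^2 \<Rightarrow> real) \<Rightarrow> bool" where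
  "solves_M2 = solves_cauchy integrand_M2"

end

theory Submission
  imports Defs
begin

text \<open>
  The integrands agree pointwise: with \<open>a = \<Delta>\<^sub>y f(t,x)\<close>, the Laplace transform of \<open>k \<mapsto> cos (a k)\<close> at 1
  is \<open>1 / (1 + a\<^sup>2)\<close> and \<open>cos (arctan a) = (1 + a\<^sup>2)\<^bsup>-1/2\<^esup>\<close>, so their product is \<open>(1 + a\<^sup>2)\<^bsup>-3/2\<^esup>\<close>.
\<close>

lemma tendsto_exp_minus_at_top: "((\<lambda>k::real. exp (- k)) \<longlongrightarrow> 0) at_top"
  by (rule filterlim_compose[OF exp_at_bot filterlim_uminus_at_bot_at_top])

lemma set_integrable_exp_minus: "set_integrable lborel {0..} (\<lambda>k::real. exp (- k))"
proof -
  have "(\<integral>\<^sup>+k. ennreal (exp (- k)) * indicator {0..} k \<partial>lborel) = ennreal (0 - (- exp (- 0)))"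
    by (rule nn_integral_FTC_atLeast)
       (use tendsto_minus[OF tendsto_exp_minus_at_top] in \<open>auto intro!: derivative_eq_intros\<close>)
  then show ?thesis
    unfolding set_integrable_def
    by (intro integrableI_nonneg) (auto simp: ennreal_mult' ennreal_indicator mult.commute)
qed

text \<open>Dominated by \<open>exp (- k)\<close>, since the cosine is at most 1 in absolute
  value.\<close>

lemma set_integrable_exp_minus_cos:
  fixes a :: real
  shows "set_integrable lborel {0..} (\<lambda>k. exp (- k) * cos (k * a))"
  by (rule set_integrable_bound[OF set_integrable_exp_minus])
     (auto simp: set_borel_measurable_def abs_mult mult_left_le)

text \<open>As b tends to infinity, the integrals over \<open>{0..b}\<close> tend to the left side
  by integrability and to the right side by the fundamental theorem of calculus; limits are
  unique.\<close>

lemma LBINT_exp_minus_cos: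
  fixes a :: real
  shows "(LBINT k:{0..}. exp (- k) * cos (k * a)) = 1 / (1 + a\<^sup>2)"
proof (rule tendsto_unique)
  \<comment> \<open>Real part of exp((-1 + ia)k) / (-1 + ia), an antiderivative of the
    integrand.\<close>
  let ?F = "\<lambda>k. exp (- k) * (a * sin (k * a) - cos (k * a)) / (1 + a\<^sup>2)"
  have pos: "1 + a\<^sup>2 \<noteq> 0"
    using add_pos_nonneg[OF zero_less_one zero_le_power2, of a] by simp
  show "((\<lambda>b. LBINT k:{0..b}. exp (- k) * cos (k * a)) \<longlongrightarrow>
      (LBINT k:{0..}. exp (- k) * cos (k * a))) at_top"
    by (rule tendsto_set_lebesgue_integral_at_top) (auto intro: set_integrable_exp_minus_cos)
  have "((\<lambda>k. exp (- k) * (a * sin (k * a) - cos (k * a))) has_real_derivative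
      (1 + a\<^sup>2) * (exp (- k) * cos (k * a))) (at k)" for k
    by (auto intro!: derivative_eq_intros simp: algebra_simps power2_eq_square)
  from DERIV_cdivide[OF this, of "1 + a\<^sup>2"]
  have deriv: "(?F has_real_derivative exp (- k) * cos (k * a)) (at k)" for k
    using pos by simp
  have "(LBINT k:{0..b}. exp (- k) * cos (k * a)) = ?F b - ?F 0" if "0 \<le> b" for b
    unfolding set_lebesgue_integral_def real_scaleR_def mult.commute[of "indicator _ _"]
    using that by (intro integral_FTC_Icc_real deriv) auto
  then have "\<forall>\<^sub>F b in at_top. ?F b - ?F 0 = (LBINT k:{0..b}. exp (- k) * cos (k * a))"
    by (auto intro: eventually_at_top_linorderI[of 0])
  moreover have "((\<lambda>b. ?F b - ?F 0) \<longlongrightarrow> 1 / (1 + a\<^sup>2)) at_top"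
  proof -
    have "((\<lambda>b. exp (- b) * (a * sin (b * a) - cos (b * a))) \<longlongrightarrow> 0) at_top"
    proof (rule Lim_null_comparison)
      \<comment> \<open>The trigonometric factor is bounded uniformly in \<open>b\<close>, so the
        exponential decay wins.\<close>
      have "\<bar>a * sin (b * a) - cos (b * a)\<bar> \<le> \<bar>a\<bar> + 1" for b
        using mult_left_le[OF abs_sin_le_one abs_ge_zero, of a "b * a"] abs_cos_le_one[of "b * a"]
        by (simp add: abs_mult[symmetric] del: abs_cos_le_one)
      then show "\<forall>\<^sub>F b in at_top. norm (exp (- b) * (a * sin (b * a) - cos (b * a)))
          \<le> exp (- b) * (\<bar>a\<bar> + 1)"
        by (intro always_eventually) (auto simp: abs_mult)
      show "((\<lambda>b. exp (- b) * (\<bar>a\<bar> + 1)) \<longlongrightarrow> 0) at_top"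
        by (intro tendsto_mult_left_zero tendsto_exp_minus_at_top)
    qed
    \<comment> \<open>What remains in the limit is \<open>- ?F 0\<close>, and \<open>?F 0\<close> is
      -1 / (1 + a^2).\<close>
    from tendsto_diff[OF tendsto_divide[OF this tendsto_const pos] tendsto_const, of "?F 0"]
    show ?thesis by simp
  qed
  ultimately show "((\<lambda>b. LBINT k:{0..b}. exp (- k) * cos (k * a)) \<longlongrightarrow> 1 / (1 + a\<^sup>2)) at_top"
    by (rule Lim_transform_eventually[rotated])
qed simp

lemma cos_arctan_times_LBINT_exp_minus_cos:
  fixes a :: real
  shows "cos (arctan a) * (LBINT k:{0..}. exp (- k) * cos (k * a)) = 1 / (1 + a\<^sup>2) powr (3/2)"
proof -
  have pos: "0 < 1 + a\<^sup>2"
    using add_pos_nonneg[OF zero_less_one zero_le_power2, of a] by simp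
  \<comment> \<open>The exponent is split so that the square root from \<open>cos_arctan\<close>
    appears.\<close>
  have "(1 + a\<^sup>2) powr (3/2) = (1 + a\<^sup>2) powr (1 + 1/2)"
    by simp
  also have "\<dots> = (1 + a\<^sup>2) * sqrt (1 + a\<^sup>2)"
    unfolding powr_add using pos by (simp add: powr_half_sqrt)
  finally show ?thesis
    by (simp add: LBINT_exp_minus_cos cos_arctan)
qed

text \<open>The scalar identity holds for every real a, so the integrands agree as functions, even
  at \<open>y = 0\<close>. Truncated integrals and principal values then coincide without any limit
  argument.\<close>

lemma integrand_M1_eq_M2: "integrand_M1 = integrand_M2"
  unfolding integrand_M1_def integrand_M2_def mult.assoc cos_arctan_times_LBINT_exp_minus_cos ..

theorem proposition3p1:
  fixes \<rho> T :: real
    and f0 :: "real^2 \<Rightarrow> real"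
    and f :: "real \<Rightarrow> real^2 \<Rightarrow> real"
  assumes "\<rho> > 0" and "T > 0"
  shows "solves_M1 \<rho> T f0 f \<longleftrightarrow> solves_M2 \<rho> T f0 f"
  unfolding solves_M1_def solves_M2_def integrand_M1_eq_M2 ..

end
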